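(* Let $N=2^p$ and let $\tilde R_n$ ($0\le n\le p$) denote the quantities computed by the algorithm $R_0=x$, $R_n=2R_{n-1}^2-1$ for $n=1,\ldots,p$ (which in exact arithmetic gives $R_p=T_N(x)$) in floating point arithmetic with machine precision $\epsilon_M$. Let $\tilde T_N(x)=\tilde R_p$. Assume that $x$ is exactly representable in this arithmetic and $x\in[-1,1]$. Then $$|\tilde T_N(x)-T_N(x)| \le \epsilon_M N^2 + O(\epsilon_M^2),$$ and $$|\tilde T_N(x)-T_N(x)| \le \epsilon_M\, N^2\, C_N(x) + O(\epsilon_M^2).$$
   Context: $T_N$ denotes the Chebyshev polynomial of the first kind of degree $N$, defined by $T_0(x)=1$, $T_1(x)=x$, $T_n(x)=2xT_{n-1}(x)-T_{n-2}(x)$ for $n\ge 2$, and $C_N(x)=|T_N(x)|+|x\,T_N'(x)|$. Floating point model: each arithmetic operation returns the exact result of the operation on its computed operands times $(1+\delta)$ with $|\delta|\le\epsilon_M$; multiplication by $2$ is exact; there is no overflow or underflow. Thus the computed quantities are any real numbers with $\tilde R_0=x$ and, for $n=1,\ldots,p$, $$\tilde R_n = \bigl(2\tilde R_{n-1}^2(1+\alpha_n)-1\bigr)(1+\beta_n),\qquad |\alpha_n|,|\beta_n|\le\epsilon_M.$$ $O(\epsilon_M^2)$ means: there exist $K,\epsilon_0>0$, depending only on $N$, such that for all $0<\epsilon_M\le\epsilon_0$, all admissible $x$ and all admissible rounding errors the term is bounded in absolute value by $K\epsilon_M^2$. *)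

theory Defs
  imports "HOL-Analysis.Analysis" "HOL-Computational_Algebra.Polynomial"
begin

fun cheb_poly :: "nat \<Rightarrow> real poly" where
  "cheb_poly 0 = 1"
| "cheb_poly (Suc 0) = [:0, 1:]"
| "cheb_poly (Suc (Suc n)) = 2 * [:0, 1:] * cheb_poly (Suc n) - cheb_poly n"

definition cheb_cond :: "nat \<Rightarrow> real \<Rightarrow> real" where
  "cheb_cond N x = \<bar>poly (cheb_poly N) x\<bar> + \<bar>x * poly (pderiv (cheb_poly N)) x\<bar>"

text \<open>
  Possible outcomes of the iteration R 0 = x, R n = 2 * (R (n - 1))^2 - 1 in floating point
  arithmetic with machine precision eps: the squaring and the subtraction incur the relative
  errors a and b, which may differ from step to step; doubling is exact. The input x is
  representable, hence carries no error. With eps = 0 this is the exact iteration.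
\<close>

definition fl_doubling :: "real \<Rightarrow> real \<Rightarrow> nat \<Rightarrow> (nat \<Rightarrow> real) \<Rightarrow> bool" where
  "fl_doubling eps x p R \<longleftrightarrow>
     R 0 = x \<and>
     (\<forall>n\<in>{1..p}. \<exists>a b. \<bar>a\<bar> \<le> eps \<and> \<bar>b\<bar> \<le> eps \<and>
        R n = (2 * (R (n - 1))\<^sup>2 * (1 + a) - 1) * (1 + b))"

lemma cheb_poly_mult:
  "2 * poly (cheb_poly (m + n)) x * poly (cheb_poly m) x =
     poly (cheb_poly (2 * m + n)) x + poly (cheb_poly n) x"
proof (induction m arbitrary: n rule: less_induct)
  case (less m)
  consider "m = 0" | "m = 1" | k where "m = Suc (Suc k)"
    by (metis One_nat_def not0_implies_Suc)
  then show ?case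
  proof cases
    case 3
    define T where "T = (\<lambda>i. poly (cheb_poly i) x)"
    have rec: "T (Suc (Suc i)) = 2 * x * T (Suc i) - T i" for i
      by (simp add: T_def)
    have 1: "2 * T (Suc k + Suc n) * T (Suc k) = T (2 * Suc k + Suc n) + T (Suc n)"
      using less.IH[of "Suc k" "Suc n"] 3 by (simp add: T_def)
    have 2: "2 * T (k + Suc (Suc n)) * T k = T (2 * k + Suc (Suc n)) + T (Suc (Suc n))"
      using less.IH[of k "Suc (Suc n)"] 3 by (simp add: T_def)
    have "2 * T (m + n) * T m = 2 * x * (2 * T (m + n) * T (Suc k)) - 2 * T (m + n) * T k"
      unfolding 3 rec[of k] by (simp only: algebra_simps)
    also have "\<dots> = 2 * x * (T (Suc (2 * k + n + 2)) + T (Suc n))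
                   - (T (2 * k + n + 2) + T (Suc (Suc n)))"
      using 1 2 3 by simp
    also have "\<dots> = T (2 * m + n) + T n"
      using rec[of "2 * k + n + 2"] rec[of n] 3 by (simp add: algebra_simps)
    finally show ?thesis by (simp add: T_def)
  qed simp_all
qed

lemma fl_doubling_exact:
  assumes "fl_doubling 0 x p R" and "n \<le> p"
  shows "R n = poly (cheb_poly (2 ^ n)) x"
  using assms(2)
proof (induction n)
  case 0
  then show ?case using assms(1) by (simp add: fl_doubling_def)
next
  case (Suc n)
  have "R (Suc n) = 2 * (R n)\<^sup>2 - 1"
    using assms(1) Suc.prems by (auto simp: fl_doubling_def dest!: bspec[of _ _ "Suc n"])
  then show ?case
    using Suc cheb_poly_mult[of "2 ^ n" 0 x] by (simp add: power2_eq_square)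
qed

end

theory Submission
  imports Defs
begin

text \<open>
  To first order the error at step \<open>n\<close> is at most four times the previous error plus \<open>3 * eps\<close>, since
  all exact iterates lie in \<open>[-1, 1]\<close>. Starting from \<open>0\<close> this accumulates to \<open>(4 ^ p - 1) * eps\<close>, and
  \<open>4 ^ p = N\<^sup>2\<close>. For \<open>p \<ge> 1\<close> the second bound is weaker than the first, because
  \<open>\<bar>x * T' x\<bar> \<ge> 1 - (T x)\<^sup>2\<close> for \<open>T\<close> of degree \<open>2 ^ p\<close>, so that
  \<open>cheb_cond N x \<ge> \<bar>T x\<bar> + 1 - (T x)\<^sup>2 \<ge> 1\<close>. For \<open>p = 0\<close> there is no error at all.
\<close>

lemma poly_cheb_poly_cos: "poly (cheb_poly n) (cos t) = cos (real n * t)"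
proof (induction n rule: cheb_poly.induct)
  case (3 n)
  have "cos (real (Suc (Suc n)) * t) = cos (real (Suc n) * t + t)"
    by (simp add: algebra_simps)
  moreover have "cos (real n * t) = cos (real (Suc n) * t - t)"
    by (simp add: algebra_simps)
  ultimately have "cos (real (Suc (Suc n)) * t) = 2 * cos t * cos (real (Suc n) * t) - cos (real n * t)"
    by (simp only: cos_add cos_diff) simp
  then show ?case
    using 3 by simp
qed simp_all

lemma abs_poly_cheb_poly_le_1:
  assumes "x \<in> {-1..1}"
  shows "\<bar>poly (cheb_poly n) x\<bar> \<le> 1"
  using poly_cheb_poly_cos[of n "arccos x"] assms by simp

text \<open>An identity of polynomials rather than of values, so that it can be
  differentiated.\<close>

lemma cheb_poly_double: "cheb_poly (2 * n) = 2 * (cheb_poly n)\<^sup>2 - 1"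
proof -
  have "poly (cheb_poly (2 * n)) x = poly (2 * (cheb_poly n)\<^sup>2 - 1) x" for x
    using cheb_poly_mult[of n 0 x] by (simp add: power2_eq_square)
  then show ?thesis
    by (simp add: poly_eq_poly_eq_iff[symmetric] fun_eq_iff)
qed

lemma poly_pderiv_cheb_poly_double:
  "poly (pderiv (cheb_poly (2 * n))) x =
     4 * poly (cheb_poly n) x * poly (pderiv (cheb_poly n)) x"
proof -
  have "cheb_poly (2 * n) = cheb_poly n * cheb_poly n + cheb_poly n * cheb_poly n - 1"
    using cheb_poly_double[of n] mult_2[of "(cheb_poly n)\<^sup>2"] by (simp only: power2_eq_square)
  then show ?thesis
    by (simp add: pderiv_mult pderiv_diff pderiv_add)
qed

text \<open>Doubling takes value \<open>t\<close> and derivative \<open>d\<close> to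
  \<open>2 * t\<^sup>2 - 1\<close> and \<open>4 * t * d\<close>, which preserves the inequality. The
  exponent starts at \<open>Suc 0\<close> because degree 1 fails at \<open>x = 0\<close>.\<close>

lemma abs_mult_pderiv_cheb_poly_ge:
  assumes "x \<in> {-1..1}"
  shows "1 - (poly (cheb_poly (2 ^ Suc n)) x)\<^sup>2 \<le> \<bar>x * poly (pderiv (cheb_poly (2 ^ Suc n))) x\<bar>"
proof (induction n)
  case 0
  \<comment> \<open>The two sides differ by \<open>4 * (x\<^sup>2)\<^sup>2\<close>.\<close>
  have "1 - (2 * x\<^sup>2 - 1)\<^sup>2 \<le> 4 * x\<^sup>2"
    using zero_le_power[of "x\<^sup>2" 2] by (simp add: power2_eq_square algebra_simps)
  moreover have "poly (cheb_poly 2) x = 2 * x\<^sup>2 - 1"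
    using cheb_poly_double[of 1] by (simp add: power2_eq_square)
  moreover have "poly (pderiv (cheb_poly 2)) x = 4 * x"
    using poly_pderiv_cheb_poly_double[of 1 x] by (simp add: pderiv_pCons)
  moreover have "\<bar>x * (4 * x)\<bar> = 4 * x\<^sup>2"
    by (simp add: abs_mult power2_eq_square)
  ultimately show ?case
    by simp
next
  case (Suc n)
  define t where "t = poly (cheb_poly (2 ^ Suc n)) x"
  define d where "d = poly (pderiv (cheb_poly (2 ^ Suc n))) x"
  have t1: "\<bar>t\<bar> \<le> 1"
    using abs_poly_cheb_poly_le_1[OF assms] by (simp add: t_def)
  have "1 - (2 * t\<^sup>2 - 1)\<^sup>2 = 4 * \<bar>t\<bar> * (\<bar>t\<bar> * (1 - t\<^sup>2))"
    by (simp add: power2_eq_square algebra_simps)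
  \<comment> \<open>Only one of the two factors \<open>\<bar>t\<bar>\<close> is given away; the
    other is needed for the new derivative.\<close>
  also have "\<dots> \<le> 4 * \<bar>t\<bar> * (1 * (1 - t\<^sup>2))"
    using t1 by (intro mult_left_mono mult_right_mono) (auto simp: abs_square_le_1)
  also have "\<dots> \<le> 4 * \<bar>t\<bar> * \<bar>x * d\<bar>"
    using Suc by (intro mult_left_mono) (auto simp: t_def d_def)
  also have "\<dots> = \<bar>x * (4 * t * d)\<bar>"
    by (simp add: abs_mult)
  finally show ?case
    using cheb_poly_double[of "2 ^ Suc n"] poly_pderiv_cheb_poly_double[of "2 ^ Suc n" x]
    by (simp add: t_def d_def)
qed

lemma cheb_cond_ge_1:
  assumes "x \<in> {-1..1}"
  shows "1 \<le> cheb_cond (2 ^ Suc n) x"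
proof -
  define t where "t = poly (cheb_poly (2 ^ Suc n)) x"
  have "\<bar>t\<bar> \<le> 1"
    using abs_poly_cheb_poly_le_1[OF assms] by (simp add: t_def)
  then have "\<bar>t\<bar> * \<bar>t\<bar> \<le> \<bar>t\<bar>"
    by (simp only: mult_left_le abs_ge_zero)
  then have "t\<^sup>2 \<le> \<bar>t\<bar>"
    by (simp add: power2_eq_square)
  then show ?thesis
    using abs_mult_pderiv_cheb_poly_ge[OF assms, of n]
    unfolding cheb_cond_def t_def by linarith
qed

text \<open>Here \<open>t\<close> is the exact iterate, \<open>e\<close> the inherited error, and
  \<open>a\<close>, \<open>b\<close> the new rounding errors. Of the \<open>3 * eps\<close>, two
  come from the squaring and one from the subtraction. The a priori bound \<open>M * eps\<close>
  enters only the second-order term, so the factor 4 on \<open>\<bar>e\<bar>\<close> stays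
  sharp.\<close>

lemma doubling_step_error:
  fixes t e a b eps M :: real
  assumes t: "\<bar>t\<bar> \<le> 1" and a: "\<bar>a\<bar> \<le> eps" and b: "\<bar>b\<bar> \<le> eps"
    and e: "\<bar>e\<bar> \<le> M * eps" and eps: "eps \<le> 1" and M: "0 \<le> M"
  shows "\<bar>(2 * (t + e)\<^sup>2 * (1 + a) - 1) * (1 + b) - (2 * t\<^sup>2 - 1)\<bar>
           \<le> 4 * \<bar>e\<bar> + 3 * eps + (2 * M\<^sup>2 + 6 * (2 * M + M\<^sup>2) + 2) * eps\<^sup>2"
proof -
  \<comment> \<open>\<open>q\<close> is the error \<open>(t + e)\<^sup>2 - t\<^sup>2\<close> of the
    square, and \<open>Q * eps\<close> will bound it.\<close>
  define q where "q = 2 * t * e + e\<^sup>2"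
  define Q where "Q = 2 * M + M\<^sup>2"
  have eps0: "0 \<le> eps"
    using a by linarith
  have t2: "t\<^sup>2 \<le> 1"
    using t by (simp add: abs_square_le_1)
  have e2: "e\<^sup>2 \<le> M\<^sup>2 * eps\<^sup>2"
    using power_mono[OF e abs_ge_zero, of 2] by (simp add: power_mult_distrib)
  have eps2: "eps\<^sup>2 \<le> eps"
    using eps eps0 by (simp add: power2_eq_square mult_left_le)
  have "\<bar>t * e\<bar> \<le> M * eps"
    using mult_mono[OF t e] by (simp add: abs_mult)
  moreover have "M\<^sup>2 * eps\<^sup>2 \<le> M\<^sup>2 * eps"
    using eps2 by (intro mult_left_mono) auto
  moreover have "\<bar>e\<^sup>2\<bar> = e\<^sup>2"
    by simp
  ultimately have q: "\<bar>q\<bar> \<le> Q * eps"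
    using e2 unfolding q_def Q_def distrib_right by linarith
  have prod: "\<bar>u * v\<bar> \<le> C * eps\<^sup>2" if "\<bar>u\<bar> \<le> eps" "\<bar>v\<bar> \<le> C * eps" for u v C
    using mult_mono[OF that eps0] by (simp add: abs_mult power2_eq_square algebra_simps)
  have te: "\<bar>t * e\<bar> \<le> \<bar>e\<bar>"
    using t by (simp add: abs_mult mult_right_le_one_le mult.commute)
  have ta: "\<bar>t\<^sup>2 * a\<bar> \<le> eps"
    using mult_mono[OF t2 a] by (simp add: abs_mult)
  have tb: "\<bar>(2 * t\<^sup>2 - 1) * b\<bar> \<le> eps"
  proof -
    have "\<bar>2 * t\<^sup>2 - 1\<bar> \<le> 1"
      using t2 zero_le_power2[of t] by linarith
    from mult_mono[OF this b] show ?thesis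
      by (simp add: abs_mult)
  qed
  have aq: "\<bar>a * q\<bar> \<le> Q * eps\<^sup>2" and bq: "\<bar>b * q\<bar> \<le> Q * eps\<^sup>2"
    using prod a b q by blast+
  have abq: "\<bar>b * (a * (t\<^sup>2 + q))\<bar> \<le> (1 + Q) * eps\<^sup>2"
  proof (rule prod[OF b])
    have "Q * eps \<le> Q"
      using eps M by (simp add: Q_def mult_left_le)
    then have "\<bar>t\<^sup>2 + q\<bar> \<le> 1 + Q"
      using t2 q zero_le_power2[of t] by linarith
    from mult_mono[OF a this] show "\<bar>a * (t\<^sup>2 + q)\<bar> \<le> (1 + Q) * eps"
      using eps0 by (simp add: abs_mult mult.commute)
  qed
  \<comment> \<open>The first three summands are of first order, the other four of second
    order.\<close>
  have split: "(2 * (t + e)\<^sup>2 * (1 + a) - 1) * (1 + b) - (2 * t\<^sup>2 - 1) =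
      4 * (t * e) + 2 * (t\<^sup>2 * a) + (2 * t\<^sup>2 - 1) * b + 2 * e\<^sup>2 + 2 * (a * q) + 2 * (b * q)
      + 2 * (b * (a * (t\<^sup>2 + q)))"
    by (simp add: q_def power2_eq_square algebra_simps)
  have total: "(2 * M\<^sup>2 + 6 * Q + 2) * eps\<^sup>2 =
      2 * (M\<^sup>2 * eps\<^sup>2) + 2 * (Q * eps\<^sup>2) + 2 * (Q * eps\<^sup>2) + 2 * ((1 + Q) * eps\<^sup>2)"
    by (simp add: algebra_simps)
  \<comment> \<open>The triangle inequality is stated for fresh variables to keep the arithmetic
    linear.\<close>
  have sum: "\<bar>4 * u1 + 2 * u2 + u3 + 2 * u4 + 2 * u5 + 2 * u6 + 2 * u7\<bar>
      \<le> 4 * v1 + 3 * v2 + (2 * v4 + 2 * v5 + 2 * v5 + 2 * v7)"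
    if "\<bar>u1\<bar> \<le> v1" "\<bar>u2\<bar> \<le> v2" "\<bar>u3\<bar> \<le> v2" "\<bar>u4\<bar> \<le> v4" "\<bar>u5\<bar> \<le> v5" "\<bar>u6\<bar> \<le> v5" "\<bar>u7\<bar> \<le> v7"
    for u1 u2 u3 u4 u5 u6 u7 v1 v2 v4 v5 v7 :: real
    using that unfolding abs_le_iff by (intro conjI; linarith)
  have "\<bar>e\<^sup>2\<bar> \<le> M\<^sup>2 * eps\<^sup>2"
    using e2 by simp
  from sum[OF te ta tb this aq bq abq] show ?thesis
    unfolding split Q_def[symmetric] total .
qed

text \<open>The first-order coefficients obey \<open>c 0 = 0\<close>,
  \<open>c (Suc n) = 4 * c n + 3\<close>, hence \<open>c n = 4 ^ n - 1\<close>. \<open>K\<close> is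
  chosen before \<open>eps\<close>, \<open>x\<close> and \<open>R\<close>, so it depends on
  \<open>n\<close> alone.\<close>

lemma fl_doubling_error:
  "\<exists>K\<ge>0. \<forall>eps x R. 0 < eps \<and> eps \<le> 1 \<and> x \<in> {-1..1} \<and> fl_doubling eps x n R \<longrightarrow>
     \<bar>R n - poly (cheb_poly (2 ^ n)) x\<bar> \<le> (4 ^ n - 1) * eps + K * eps\<^sup>2"
proof (induction n)
  case 0
  show ?case
    by (intro exI[of _ 0]) (auto simp: fl_doubling_def)
next
  case (Suc n)
  then obtain K where K: "0 \<le> K"
    and IH: "\<And>eps x R. 0 < eps \<Longrightarrow> eps \<le> 1 \<Longrightarrow> x \<in> {-1..1} \<Longrightarrow> fl_doubling eps x n R \<Longrightarrow>
      \<bar>R n - poly (cheb_poly (2 ^ n)) x\<bar> \<le> (4 ^ n - 1) * eps + K * eps\<^sup>2"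
    by blast
  \<comment> \<open>For \<open>eps \<le> 1\<close> the quadratic term is at most
    \<open>K * eps\<close>, so \<open>M * eps\<close> bounds the inherited error.\<close>
  define M :: real where "M = 4 ^ n + K"
  define L where "L = 2 * M\<^sup>2 + 6 * (2 * M + M\<^sup>2) + 2"
  have M: "0 \<le> M"
    using K by (simp add: M_def)
  show ?case
  \<comment> \<open>The old second-order error is amplified by 4, and the step itself adds
    \<open>L\<close>.\<close>
  proof (intro exI[of _ "4 * K + L"] conjI allI impI)
    show "0 \<le> 4 * K + L"
      using K M by (simp add: L_def)
  next
    fix eps x :: real and R :: "nat \<Rightarrow> real"
    assume asm: "0 < eps \<and> eps \<le> 1 \<and> x \<in> {-1..1} \<and> fl_doubling eps x (Suc n) R"
    define t where "t = poly (cheb_poly (2 ^ n)) x"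
    define e where "e = R n - t"
    have "fl_doubling eps x n R"
      using asm by (auto simp: fl_doubling_def)
    then have e: "\<bar>e\<bar> \<le> (4 ^ n - 1) * eps + K * eps\<^sup>2"
      using IH asm unfolding e_def t_def by blast
    have "eps\<^sup>2 \<le> eps"
      using asm by (simp add: power2_eq_square mult_left_le)
    then have "K * eps\<^sup>2 \<le> K * eps"
      using K by (rule mult_left_mono)
    then have eM: "\<bar>e\<bar> \<le> M * eps"
      using e asm unfolding M_def by (simp add: algebra_simps)
    obtain a b where ab: "\<bar>a\<bar> \<le> eps" "\<bar>b\<bar> \<le> eps"
      and R: "R (Suc n) = (2 * (t + e)\<^sup>2 * (1 + a) - 1) * (1 + b)"
      using asm by (auto simp: fl_doubling_def e_def dest!: bspec[of _ _ "Suc n"])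
    have "\<bar>t\<bar> \<le> 1"
      using abs_poly_cheb_poly_le_1 asm unfolding t_def by blast
    from doubling_step_error[OF this ab eM _ M] asm
    have "\<bar>R (Suc n) - (2 * t\<^sup>2 - 1)\<bar> \<le> 4 * \<bar>e\<bar> + 3 * eps + L * eps\<^sup>2"
      by (simp add: R L_def)
    also have "\<dots> \<le> (4 ^ Suc n - 1) * eps + (4 * K + L) * eps\<^sup>2"
      using e by (simp add: algebra_simps)
    finally show "\<bar>R (Suc n) - poly (cheb_poly (2 ^ Suc n)) x\<bar>
        \<le> (4 ^ Suc n - 1) * eps + (4 * K + L) * eps\<^sup>2"
      using cheb_poly_double[of "2 ^ n"] by (simp add: t_def)
  qed
qed

theorem theorem4:
  fixes p N :: nat
  assumes "N = 2 ^ p"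
  shows "(\<exists>K>0. \<exists>eps0>0. \<forall>eps x. \<forall>R :: nat \<Rightarrow> real.
            0 < eps \<and> eps \<le> eps0 \<and> x \<in> {-1..1} \<and> fl_doubling eps x p R \<longrightarrow>
            \<bar>R p - poly (cheb_poly N) x\<bar> \<le> eps * (real N)\<^sup>2 + K * eps\<^sup>2) \<and>
         (\<exists>K>0. \<exists>eps0>0. \<forall>eps x. \<forall>R :: nat \<Rightarrow> real.
            0 < eps \<and> eps \<le> eps0 \<and> x \<in> {-1..1} \<and> fl_doubling eps x p R \<longrightarrow>
            \<bar>R p - poly (cheb_poly N) x\<bar> \<le> eps * (real N)\<^sup>2 * cheb_cond N x + K * eps\<^sup>2)"
proof -
  obtain K where K: "0 \<le> K"
    and err: "\<And>eps x R. 0 < eps \<Longrightarrow> eps \<le> 1 \<Longrightarrow> x \<in> {-1..1} \<Longrightarrow> fl_doubling eps x p R \<Longrightarrow>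
      \<bar>R p - poly (cheb_poly N) x\<bar> \<le> (4 ^ p - 1) * eps + K * eps\<^sup>2"
    using fl_doubling_error[of p] unfolding assms by blast
  have N2: "(real N)\<^sup>2 = 4 ^ p"
    by (simp add: assms power_mult_distrib[symmetric] power2_eq_square)
  \<comment> \<open>\<open>K\<close> may be 0 while the theorem asks for a positive constant, hence
    \<open>K + 1\<close>.\<close>
  have bound: "\<bar>R p - poly (cheb_poly N) x\<bar> \<le> eps * (real N)\<^sup>2 + (K + 1) * eps\<^sup>2"
    if "0 < eps" "eps \<le> 1" "x \<in> {-1..1}" "fl_doubling eps x p R" for eps x R
    using err[OF that] that(1) zero_le_power2[of eps]
    unfolding N2 left_diff_distrib distrib_right mult.commute[of eps] by linarith
  have cond: "\<bar>R p - poly (cheb_poly N) x\<bar> \<le> eps * (real N)\<^sup>2 * cheb_cond N x + (K + 1) * eps\<^sup>2"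
    if that: "0 < eps" "eps \<le> 1" "x \<in> {-1..1}" "fl_doubling eps x p R" for eps x R
  \<comment> \<open>For \<open>p = 0\<close> the condition number is
    \<open>2 * \<bar>x\<bar>\<close>, which can be below 1, so this case rests on the error being
    zero.\<close>
  proof (cases p)
    case 0
    then show ?thesis
      using that K assms by (simp add: fl_doubling_def cheb_cond_def)
  next
    case (Suc n)
    have "eps * (real N)\<^sup>2 * 1 \<le> eps * (real N)\<^sup>2 * cheb_cond N x"
      using cheb_cond_ge_1[OF that(3), of n] that(1) unfolding assms Suc
      by (intro mult_left_mono) auto
    then show ?thesis
      using bound[OF that] by simp
  qed
  have "0 < K + 1"
    using K by simp
  then show ?thesis
    using bound cond zero_less_one by blast
qed

end
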